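(* (i) Let $\ell,k$ be positive integers with $\ell\ge k$ and let $\lambda\in\mathcal P^k_{\mathrm{sq}}$. Then $$\#\mathcal P^\ell(\lambda)=\begin{cases} c_{\ell-k+1}, & \lambda=\tau_k\lambda,\\ 2c_{\ell-k+1}, & \lambda\neq\tau_k\lambda.\end{cases}$$ (ii) Let $k,s$ be positive integers, $\lambda\in\mathcal P^k_{\mathrm{sq}}$ and $\nu\in\mathcal P^s_{\mathrm{sq}}$ with $\nu\notin\{\lambda,\tau_k\lambda\}$. Then for all integers $\ell\ge\max(k,s)$ we have $\mathcal P^\ell(\lambda)\cap\mathcal P^\ell(\nu)=\emptyset$. (iii) For every positive integer $\ell$, the set $\mathcal P^\ell$ is the disjoint union $$\mathcal P^\ell=\bigsqcup \mathcal P^\ell(\lambda),$$ where $\lambda$ runs over $\bigcup_{1\le k\le \ell}\mathcal P^k_{\mathrm{sq}}$, with $\lambda\in\mathcal P^k_{\mathrm{sq}}$ and $\tau_k\lambda$ (for which $\mathcal P^\ell(\lambda)=\mathcal P^\ell(\tau_k\lambda)$) counted only once, i.e. one $\lambda$ is taken from each set $\{\lambda,\tau_k\lambda\}$.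
   Context: A partition with $n$ parts is a sequence $\lambda=(\lambda_1\ge\lambda_2\ge\cdots\ge\lambda_n>0)$ of positive integers. For $n\ge 2$ write $\lambda\setminus\{\lambda_n\}=(\lambda_1\ge\cdots\ge\lambda_{n-1})$. For positive integers $n,k$, $\mathcal P^{n,k}$ is the set of partitions with exactly $n$ parts and $\lambda_1\le k$; $\tau_k:\mathcal P^{n,k}\to\mathcal P^{n,k}$ is the involution $\tau_k(\lambda_1\ge\cdots\ge\lambda_n)=(k+1-\lambda_n\ge\cdots\ge k+1-\lambda_1)$. Set $\mathcal P^k=\mathcal P^{k,k}$ and $\mathcal P^k_{\mathrm{sq}}=\{\lambda\in\mathcal P^k:\lambda_1=k,\ \lambda_k=1\}$. For $\lambda\in\mathcal P^k$ define subsets $\mathcal P^\ell(\lambda)\subset\mathcal P^\ell$ for $\ell\ge k$ inductively: $\mathcal P^k(\lambda)=\{\lambda,\tau_k\lambda\}$, and for $\ell>k$, $\mathcal P^\ell(\lambda)=\mathcal P^\ell_{\mathrm d}(\lambda)\cup\mathcal P^\ell_\tau(\lambda)$, where $\mathcal P^\ell_{\mathrm d}(\lambda)=\{\mu\in\mathcal P^\ell:\mu\setminus\{\mu_\ell\}\in\mathcal P^{\ell-1}(\lambda)\}$ and $\mathcal P^\ell_\tau(\lambda)=\tau_\ell\,\mathcal P^\ell_{\mathrm d}(\lambda)$. The Catalan numbers are $c_\ell=\binom{2\ell}{\ell}-\binom{2\ell}{\ell-1}$ (with $\binom{n}{-1}=0$). *)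

theory Defs
  imports Main "HOL-Library.Disjoint_Sets"
begin

text \<open>A partition is the list of its parts in weakly decreasing order, so that
  \<open>lam ! (i - 1)\<close> is the \<open>i\<close>-th part, \<open>hd lam\<close> the largest and \<open>last lam\<close> the smallest one.\<close>

definition is_partition :: "nat list \<Rightarrow> bool" where
  "is_partition lam \<longleftrightarrow> sorted_wrt (\<ge>) lam \<and> (\<forall>x\<in>set lam. x > 0)"

text \<open>Only used for positive \<open>n\<close>, where \<open>hd lam\<close> is meaningful.\<close>

definition box_partitions :: "nat \<Rightarrow> nat \<Rightarrow> nat list set" where
  "box_partitions n k = {lam. is_partition lam \<and> length lam = n \<and> hd lam \<le> k}"

abbreviation square_partitions :: "nat \<Rightarrow> nat list set" where
  "square_partitions k \<equiv> box_partitions k k"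

definition sq_partitions :: "nat \<Rightarrow> nat list set" where
  "sq_partitions k = {lam \<in> square_partitions k. hd lam = k \<and> last lam = 1}"

text \<open>No truncation occurs in the subtraction when all parts are at most \<open>k\<close>.\<close>

definition tau :: "nat \<Rightarrow> nat list \<Rightarrow> nat list" where
  "tau k lam = map (\<lambda>x. k + 1 - x) (rev lam)"

definition extensions :: "nat \<Rightarrow> nat list set \<Rightarrow> nat list set" where
  "extensions l S = {mu \<in> square_partitions l. butlast mu \<in> S}"

text \<open>\<open>descendants k lam l\<close> is the set $\mathcal{P}^l(\lambda)$ for \<open>lam\<close> in
  \<open>square_partitions k\<close> and \<open>l \<ge> k\<close>; the value for \<open>l < k\<close> is a dummy.\<close>

fun descendants :: "nat \<Rightarrow> nat list \<Rightarrow> nat \<Rightarrow> nat list set" where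
  "descendants k lam l =
    (if l < k then {}
     else if l = k then {lam, tau k lam}
     else extensions l (descendants k lam (l - 1))
          \<union> tau l ` extensions l (descendants k lam (l - 1)))"

declare descendants.simps [simp del]

text \<open>Integer-valued to avoid truncated subtraction; the case distinction is the
  convention that the binomial coefficient with lower index \<open>-1\<close> vanishes.\<close>

definition catalan :: "nat \<Rightarrow> int" where
  "catalan l = int ((2 * l) choose l) - (if l = 0 then 0 else int ((2 * l) choose (l - 1)))"

text \<open>\<open>R\<close> contains exactly one element of each set \<open>{lam, tau k lam}\<close> with
  \<open>lam \<in> sq_partitions k\<close> and \<open>1 \<le> k \<le> l\<close>, and nothing else.\<close>

definition is_transversal :: "nat \<Rightarrow> nat list set \<Rightarrow> bool" where
  "is_transversal l R \<longleftrightarrow>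
     R \<subseteq> (\<Union>k\<in>{1..l}. sq_partitions k) \<and>
     (\<forall>k\<in>{1..l}. \<forall>lam\<in>sq_partitions k. \<exists>!mu. mu \<in> R \<and> mu \<in> {lam, tau k lam})"

lemma parts_le_hd: "is_partition lam \<Longrightarrow> x \<in> set lam \<Longrightarrow> x \<le> hd lam"
  by (cases lam) (auto simp: is_partition_def)

lemma tau_tau:
  assumes "lam \<in> square_partitions k"
  shows "tau k (tau k lam) = lam"
proof -
  have "\<forall>x\<in>set lam. x \<le> k"
    using assms parts_le_hd unfolding box_partitions_def by fastforce
  then have "map (\<lambda>x. k + 1 - (k + 1 - x)) lam = lam"
    by (intro map_idI) fastforce
  then show ?thesis by (simp add: tau_def rev_map comp_def)
qed

lemma tau_sq:
  assumes "lam \<in> sq_partitions k" "k > 0"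
  shows "tau k lam \<in> sq_partitions k"
proof -
  have p: "is_partition lam" "length lam = k" "hd lam = k" "last lam = 1" "lam \<noteq> []"
    using assms by (auto simp: sq_partitions_def box_partitions_def)
  have le: "\<forall>x\<in>set lam. x \<le> k" using p parts_le_hd by fastforce
  have "sorted_wrt (\<lambda>x y. x \<ge> y) lam" using p by (simp add: is_partition_def)
  then have "sorted_wrt (\<lambda>x y. k + 1 - y \<ge> k + 1 - x) lam"
    by (rule sorted_wrt_mono_rel[rotated]) auto
  then have "sorted_wrt (\<ge>) (tau k lam)"
    by (simp add: tau_def sorted_wrt_map sorted_wrt_rev)
  moreover have "\<forall>x\<in>set (tau k lam). x > 0" using le by (auto simp: tau_def)
  moreover have "hd (tau k lam) = k" "last (tau k lam) = 1"
    using p by (simp_all add: tau_def hd_map last_map hd_rev last_rev)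
  ultimately show ?thesis
    using p by (simp add: sq_partitions_def box_partitions_def is_partition_def tau_def)
qed

lemma transversal_exists: "\<exists>R. is_transversal l R"
proof -
  define pr where "pr lam = {lam, tau (length lam) lam}" for lam :: "nat list"
  define U where "U = (\<Union>k\<in>{1..l}. sq_partitions k)"
  define f where "f S = (SOME x. x \<in> S)" for S :: "nat list set"
  define R where "R = (f \<circ> pr) ` U"
  have fpr: "f (pr lam) \<in> pr lam" for lam
    unfolding f_def by (rule someI[of _ lam]) (simp add: pr_def)
  have len: "length lam = k" if "lam \<in> sq_partitions k" for lam k
    using that by (simp add: sq_partitions_def box_partitions_def)
  have pr_eq: "pr lam = {lam, tau k lam}" if "lam \<in> sq_partitions k" for lam k
    using len[OF that] by (simp add: pr_def)
  have prU: "pr lam \<subseteq> U \<and> (\<forall>x\<in>pr lam. pr x = pr lam)" if lamU: "lam \<in> U" for lam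
  proof -
    obtain k where k: "k \<in> {1..l}" "lam \<in> sq_partitions k" using lamU unfolding U_def by blast
    have t: "tau k lam \<in> sq_partitions k" by (rule tau_sq) (use k in auto)
    have tt: "tau k (tau k lam) = lam" by (rule tau_tau) (use k in \<open>simp add: sq_partitions_def\<close>)
    have e: "pr (tau k lam) = pr lam"
      unfolding pr_eq[OF t] pr_eq[OF k(2)] tt by (rule insert_commute)
    have "lam \<in> U" "tau k lam \<in> U" unfolding U_def using k(1) k(2) t by (blast, blast)
    moreover have "x = lam \<or> x = tau k lam" if "x \<in> pr lam" for x
      using that unfolding pr_eq[OF k(2)] by simp
    ultimately show ?thesis using e by (metis subsetI)
  qed
  have preq: "pr x = pr lam" if "lam \<in> U" "x \<in> pr lam" for x lam
    using that prU by blast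
  have "R \<subseteq> U" using fpr prU unfolding R_def comp_def by blast
  moreover have "\<exists>!mu. mu \<in> R \<and> mu \<in> {lam, tau k lam}"
    if "k \<in> {1..l}" "lam \<in> sq_partitions k" for k lam
  proof -
    have U: "lam \<in> U" using that unfolding U_def by blast
    have e: "{lam, tau k lam} = pr lam" by (rule pr_eq[symmetric, OF that(2)])
    show ?thesis unfolding e
    proof (rule ex1I)
      show "f (pr lam) \<in> R \<and> f (pr lam) \<in> pr lam" using U fpr unfolding R_def comp_def by blast
    next
      fix mu assume mu: "mu \<in> R \<and> mu \<in> pr lam"
      then obtain nu where nu: "nu \<in> U" "mu = f (pr nu)" unfolding R_def comp_def by blast
      have "pr mu = pr nu" using preq fpr nu by blast
      moreover have "pr mu = pr lam" using preq U mu by blast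
      ultimately show "mu = f (pr lam)" using nu by simp
    qed
  qed
  ultimately have "is_transversal l R"
    unfolding is_transversal_def U_def by (intro conjI ballI)
  then show ?thesis by (rule exI)
qed

end

theory Submission
  imports Defs
begin

text \<open>
  Two ways of shrinking a partition in \<open>square_partitions (Suc n)\<close> to one in
  \<open>square_partitions n\<close> govern everything: deleting the last part, possible when the largest part
  is at most \<open>n\<close>, and its conjugate under \<open>tau\<close>, which deletes the first part and lowers all others
  by one (\<open>peel\<close>), possible when the last part is at least 2. A partition admits neither exactly when
  it is in \<open>sq_partitions\<close>. When both are possible they commute, so by the diamond property every
  partition shrinks to a well-defined irreducible one, its \<open>core\<close>, whatever the order of the
  steps (\<open>core_peel\<close>); consequently taking cores commutes with \<open>tau\<close> (\<open>core_tau\<close>).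

  Hence \<open>descendants k lam l\<close> is the set of partitions in \<open>square_partitions l\<close> whose core is
  \<open>lam\<close> or \<open>tau k lam\<close> (\<open>descendants_core\<close>). Disjointness and exhaustion are then mere statements
  about the fibres of a function, and only the size of a fibre remains to be found.

  For the count, fix a core and always prefer deleting the last part, so that every larger partition
  in the fibre has a unique parent. Labelling partitions by their last part, a node labelled
  \<open>a\<close> of the resulting tree has children labelled \<open>1, \<dots>, a\<close> (append a new last part) and one
  labelled \<open>a + 1\<close> (undo a peeling). This is the Catalan generating tree: the number of nodes at depth \<open>m\<close>
  with label at least \<open>a\<close> is a difference of two binomial coefficients (\<open>card_fibre\<close>), verified
  by Pascal's rule, and \<open>a = 0\<close> gives the Catalan number.
\<close>

section \<open>Shrinking steps\<close>

lemma mem_square: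
  assumes "n > 0"
  shows "mu \<in> square_partitions n \<longleftrightarrow>
    length mu = n \<and> sorted_wrt (\<ge>) mu \<and> (\<forall>x\<in>set mu. 1 \<le> x \<and> x \<le> n)"
proof -
  have "hd mu \<in> set mu" if "length mu = n" using that assms by (cases mu) auto
  then show ?thesis
    using parts_le_hd[of mu] unfolding box_partitions_def
    by (fastforce simp: is_partition_def Suc_le_eq)
qed

lemma last_le:
  assumes "sorted_wrt (\<ge>) mu" "x \<in> set mu"
  shows "last mu \<le> (x :: nat)"
  using assms by (cases mu rule: rev_cases) (auto simp: sorted_wrt_append)

lemma square_hd_last:
  assumes "mu \<in> square_partitions n" "n > 0"
  shows "mu \<noteq> []" "length mu = n" "1 \<le> last mu" "last mu \<le> hd mu" "hd mu \<le> n"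
    "x \<in> set mu \<Longrightarrow> last mu \<le> x" "x \<in> set mu \<Longrightarrow> x \<le> hd mu"
proof -
  have *: "length mu = n" "sorted_wrt (\<ge>) mu" "\<forall>x\<in>set mu. 1 \<le> x \<and> x \<le> n"
    using assms mem_square by auto
  show ne: "mu \<noteq> []" and "length mu = n" using * assms(2) by auto
  show "1 \<le> last mu" "hd mu \<le> n" "last mu \<le> hd mu"
    using ne * last_le by (auto simp: Suc_le_eq)
  show "x \<in> set mu \<Longrightarrow> last mu \<le> x" using * last_le by blast
  show "x \<in> set mu \<Longrightarrow> x \<le> hd mu"
    using assms(1) parts_le_hd by (auto simp: box_partitions_def)
qed

lemma butlast_in_square_iff:
  assumes "mu \<in> square_partitions (Suc n)" "n > 0"
  shows "butlast mu \<in> square_partitions n \<longleftrightarrow> hd mu \<le> n"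
proof -
  have mu: "length mu = Suc n" "sorted_wrt (\<ge>) mu" "\<forall>x\<in>set mu. 1 \<le> x \<and> x \<le> Suc n"
    using assms mem_square[of "Suc n" mu] by auto
  show ?thesis
  proof (cases mu rule: rev_cases)
    case Nil
    then show ?thesis using mu by simp
  next
    case (snoc ys y)
    then have "ys \<noteq> []" using mu assms(2) by auto
    then show ?thesis
      using mu snoc assms(2) square_hd_last[of ys n]
      by (cases ys) (fastforce simp: mem_square sorted_wrt_append)+
  qed
qed

definition peel :: "nat list \<Rightarrow> nat list" where
  "peel mu = map (\<lambda>x. x - 1) (tl mu)"

lemma peel_in_square:
  assumes "mu \<in> square_partitions (Suc n)" "last mu \<ge> 2"
  shows "n > 0" "peel mu \<in> square_partitions n"
proof -
  have mu: "length mu = Suc n" "sorted_wrt (\<ge>) mu" "\<forall>x\<in>set mu. 1 \<le> x \<and> x \<le> Suc n"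
    using assms mem_square[of "Suc n" mu] by auto
  have ge2: "\<forall>x\<in>set mu. 2 \<le> x" using last_le[OF mu(2)] assms(2) by fastforce
  show n: "n > 0" using square_hd_last(4,5)[OF assms(1)] assms(2) by simp
  show "peel mu \<in> square_partitions n"
  proof (cases mu)
    case Nil
    then show ?thesis using mu by simp
  next
    case (Cons y ys)
    then have "sorted_wrt (\<lambda>x y. x - 1 \<ge> y - 1) ys"
      using mu(2) by (auto elim!: sorted_wrt_mono_rel[rotated])
    then show ?thesis
      using mu ge2 Cons n by (fastforce simp: mem_square peel_def sorted_wrt_map)
  qed
qed

lemma tau_in_square:
  assumes "mu \<in> square_partitions n" "n > 0"
  shows "tau n mu \<in> square_partitions n"
proof -
  have mu: "length mu = n" "sorted_wrt (\<ge>) mu" "\<forall>x\<in>set mu. 1 \<le> x \<and> x \<le> n"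
    using assms mem_square by auto
  have "sorted_wrt (\<lambda>x y. n + 1 - y \<ge> n + 1 - x) mu"
    using mu(2) by (rule sorted_wrt_mono_rel[rotated]) auto
  then show ?thesis
    using mu assms(2) by (auto simp: mem_square tau_def sorted_wrt_map sorted_wrt_rev)
qed

lemma hd_last_tau:
  assumes "mu \<noteq> []"
  shows "hd (tau n mu) = n + 1 - last mu" "last (tau n mu) = n + 1 - hd mu"
  using assms by (simp_all add: tau_def hd_map last_map hd_rev last_rev)

lemma peel_tau: "peel (tau (Suc n) mu) = tau n (butlast mu)"
  by (cases mu rule: rev_cases) (auto simp: peel_def tau_def)

lemma butlast_tau:
  assumes "\<forall>x\<in>set mu. 1 \<le> x"
  shows "butlast (tau (Suc n) mu) = tau n (peel mu)"
proof -
  have "\<forall>x\<in>set (rev (tl mu)). Suc n + 1 - x = n + 1 - (x - 1)"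
    using assms by (cases mu) fastforce+
  then show ?thesis
    by (auto simp: peel_def tau_def map_butlast[symmetric] rev_map)
qed

section \<open>Cores\<close>

text \<open>
  By \<open>core_peel\<close> below the preference for deleting the last part does not affect the value. It is
  built in because it makes the reduction sequence unique, which the count of fibres relies on.
\<close>

function core :: "nat list \<Rightarrow> nat list" where
  "core mu =
    (if mu = [] then []
     else if hd mu < length mu then core (butlast mu)
     else if last mu \<ge> 2 then core (peel mu)
     else mu)"
  by auto
termination by (relation "measure length") (auto simp: peel_def)

declare core.simps [simp del]

lemma core_butlast: "mu \<noteq> [] \<Longrightarrow> hd mu < length mu \<Longrightarrow> core mu = core (butlast mu)"
  by (subst core.simps) simp

lemma core_sq:
  assumes "lam \<in> sq_partitions k"
  shows "core lam = lam"
  using assms by (subst core.simps) (simp add: sq_partitions_def box_partitions_def)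

text \<open>
  The diamond property: if the definition of \<open>core\<close> deletes the last part although peeling is
  possible too, then peeling stays possible afterwards and both orders give the same partition.
\<close>

lemma core_peel:
  assumes "mu \<in> square_partitions n" "n > 0" "last mu \<ge> 2"
  shows "core mu = core (peel mu)"
  using assms
proof (induction n arbitrary: mu)
  case 0
  then show ?case by simp
next
  case (Suc n)
  note mu = square_hd_last[OF Suc.prems(1,2)]
  note peel = peel_in_square[OF Suc.prems(1,3)]
  show ?case
  proof (cases "hd mu \<le> n")
    case False
    then show ?thesis using mu Suc.prems(3) by (subst core.simps) simp
  next
    case True
    have b: "butlast mu \<in> square_partitions n"
      using butlast_in_square_iff[OF Suc.prems(1) peel(1)] True by simp
    note pm = square_hd_last[OF peel(2,1)]
    have "last (butlast mu) \<in> set mu"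
      using square_hd_last(1)[OF b peel(1)] by (meson in_set_butlastD last_in_set)
    then have l2: "last (butlast mu) \<ge> 2" using mu(6) Suc.prems(3) by fastforce
    have "hd (peel mu) < length (peel mu)"
    proof -
      have "hd (peel mu) + 1 \<le> hd mu"
      proof -
        have "tl mu \<noteq> []" using pm(1) by (simp add: peel_def)
        then have "hd (tl mu) \<in> set mu" by (meson list.set_sel list.set_sel(2) mu(1))
        then have "hd (tl mu) \<le> hd mu" "1 \<le> hd (tl mu)" using mu(3) mu(6,7)[of "hd (tl mu)"] by auto
        then show ?thesis using \<open>tl mu \<noteq> []\<close> by (simp add: peel_def hd_map)
      qed
      then show ?thesis using True pm(2) by simp
    qed
    then have "core (peel mu) = core (butlast (peel mu))" using pm(1) by (rule core_butlast[rotated])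
    also have "butlast (peel mu) = peel (butlast mu)"
      by (simp add: peel_def map_butlast butlast_tl[symmetric])
    also have "core (peel (butlast mu)) = core (butlast mu)"
      using Suc.IH[OF b peel(1) l2] by simp
    also have "\<dots> = core mu" using core_butlast[of mu] mu True by simp
    finally show ?thesis by simp
  qed
qed

lemma square_cases:
  assumes "mu \<in> square_partitions n" "n > 0"
  obtains (sq) "mu \<in> sq_partitions n"
  | (butlast) n' where "n = Suc n'" "n' > 0" "hd mu \<le> n'" "butlast mu \<in> square_partitions n'"
      "core mu = core (butlast mu)"
  | (peel) n' where "n = Suc n'" "n' > 0" "hd mu = n" "last mu \<ge> 2"
      "peel mu \<in> square_partitions n'" "core mu = core (peel mu)"
proof -
  note mu = square_hd_last[OF assms]
  obtain n' where n': "n = Suc n'" using assms(2) by (cases n) auto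
  consider "hd mu \<le> n'" | "hd mu = n" "last mu \<ge> 2" | "hd mu = n" "last mu = 1"
    using mu n' by linarith
  then show thesis
  proof cases
    case 1
    then have "n' > 0" using mu by linarith
    then show thesis
      using 1 butlast n' assms butlast_in_square_iff[of mu n'] core_butlast[of mu] mu by simp
  next
    case 2
    then show thesis
      using peel n' peel_in_square[of mu n'] assms core_peel[of mu n] by simp
  next
    case 3
    then show thesis using sq assms by (simp add: sq_partitions_def)
  qed
qed

lemma core_tau:
  assumes "mu \<in> square_partitions n" "n > 0"
  shows "core (tau n mu) = tau (length (core mu)) (core mu)"
  using assms
proof (induction n arbitrary: mu)
  case 0
  then show ?case by simp
next
  case (Suc n)
  note mu = square_hd_last[OF Suc.prems]
  note t = tau_in_square[OF Suc.prems] and hl = hd_last_tau[OF mu(1), of "Suc n"]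
  from Suc.prems show ?case
  proof (cases rule: square_cases)
    case sq
    then show ?thesis using core_sq[OF sq] core_sq[OF tau_sq[OF sq]] mu by simp
  next
    case (butlast n')
    have "last (tau (Suc n) mu) \<ge> 2" using butlast hl by simp
    then have "core (tau (Suc n) mu) = core (tau n (butlast mu))"
      using core_peel[OF t] by (simp add: peel_tau)
    then show ?thesis using Suc.IH[of "butlast mu"] butlast by simp
  next
    case (peel n')
    have "hd (tau (Suc n) mu) < length (tau (Suc n) mu)" "tau (Suc n) mu \<noteq> []"
      using peel hl mu by (auto simp: tau_def)
    moreover have "\<forall>x\<in>set mu. 1 \<le> x" using mu(3,6) by fastforce
    ultimately have "core (tau (Suc n) mu) = core (tau n (peel mu))"
      using core_butlast butlast_tau[of mu n] by metis
    then show ?thesis using Suc.IH[of "peel mu"] peel by simp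
  qed
qed

lemma core_in_sq:
  assumes "mu \<in> square_partitions n" "n > 0"
  shows "core mu \<in> sq_partitions (length (core mu)) \<and> 0 < length (core mu) \<and>
    length (core mu) \<le> n \<and> (length (core mu) = n \<longrightarrow> mu \<in> sq_partitions n)"
  using assms
proof (induction n arbitrary: mu)
  case 0
  then show ?case by simp
next
  case (Suc n)
  note mu = square_hd_last[OF Suc.prems]
  from Suc.prems show ?case
  proof (cases rule: square_cases)
    case sq
    then show ?thesis using core_sq mu by simp
  next
    case (butlast n')
    then show ?thesis using Suc.IH[of "butlast mu"] by simp
  next
    case (peel n')
    then show ?thesis using Suc.IH[of "peel mu"] by simp
  qed
qed

lemma sq_length:
  assumes "lam \<in> sq_partitions k"
  shows "length lam = k" "lam \<in> square_partitions k" "last lam = 1" "hd lam = k"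
  using assms by (auto simp: sq_partitions_def box_partitions_def)

text \<open>
  In the inductive step, \<open>extensions\<close> yields exactly the partitions whose last part can be deleted;
  a reducible partition whose first part is maximal can be peeled, and \<open>tau\<close> turns it into one of
  those while conjugating its core.
\<close>

lemma descendants_core:
  assumes "lam \<in> sq_partitions k" "k > 0" "l \<ge> k"
  shows "descendants k lam l = {mu \<in> square_partitions l. core mu \<in> {lam, tau k lam}}"
  using assms(3)
proof (induction l rule: dec_induct)
  case base
  note t = tau_sq[OF assms(1,2)]
  have "mu \<in> {lam, tau k lam}"
    if "mu \<in> square_partitions k" "core mu \<in> {lam, tau k lam}" for mu
  proof -
    have "length (core mu) = k" using that(2) sq_length(1) assms(1) t by auto
    then have "mu \<in> sq_partitions k" using core_in_sq[OF that(1) assms(2)] by simp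
    then show ?thesis using core_sq that(2) by metis
  qed
  moreover have "mu \<in> square_partitions k \<and> core mu \<in> {lam, tau k lam}"
    if "mu \<in> {lam, tau k lam}" for mu
    using that core_sq[OF t] core_sq[OF assms(1)] sq_length(2)[OF t] sq_length(2)[OF assms(1)]
    by auto
  ultimately show ?case by (subst descendants.simps) auto
next
  case (step l)
  let ?C = "{lam, tau k lam}"
  have l: "l > 0" using step assms(2) by simp
  let ?E = "{mu \<in> square_partitions (Suc l). hd mu \<le> l \<and> core mu \<in> ?C}"
  have ext: "extensions (Suc l) (descendants k lam l) = ?E"
  proof -
    have "butlast mu \<in> square_partitions l \<and> core (butlast mu) \<in> ?C
        \<longleftrightarrow> hd mu \<le> l \<and> core mu \<in> ?C"
      if "mu \<in> square_partitions (Suc l)" for mu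
      using butlast_in_square_iff[OF that l] core_butlast[of mu] square_hd_last[OF that] by auto
    then show ?thesis unfolding extensions_def step.IH by auto
  qed
  have tC: "core (tau (Suc l) mu) \<in> ?C"
    if "mu \<in> square_partitions (Suc l)" "core mu \<in> ?C" for mu
  proof -
    have "length (core mu) = k" using that(2) sq_length(1) assms tau_sq by auto
    then show ?thesis
      using core_tau[OF that(1)] that(2) tau_tau[OF sq_length(2)[OF assms(1)]] by auto
  qed
  have "mu \<in> ?E \<or> mu \<in> tau (Suc l) ` ?E"
    if mu: "mu \<in> square_partitions (Suc l)" "core mu \<in> ?C" for mu
    using mu(1) zero_less_Suc
  proof (cases rule: square_cases)
    case sq
    then show ?thesis
      using mu(2) core_sq[OF sq] sq_length(1)[OF sq] sq_length(1)[OF assms(1)]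
        sq_length(1)[OF tau_sq[OF assms(1,2)]] step.hyps by auto
  next
    case (butlast n')
    then show ?thesis using mu by simp
  next
    case (peel n')
    have "hd (tau (Suc l) mu) \<le> l"
      using peel hd_last_tau(1)[of mu "Suc l"] square_hd_last(1)[OF mu(1)] by simp
    then have "tau (Suc l) mu \<in> ?E" using tau_in_square[OF mu(1)] tC[OF mu] by simp
    moreover have "mu = tau (Suc l) (tau (Suc l) mu)" using tau_tau[OF mu(1)] by simp
    ultimately show ?thesis by blast
  qed
  moreover have "mu \<in> square_partitions (Suc l) \<and> core mu \<in> ?C"
    if "mu \<in> ?E \<union> tau (Suc l) ` ?E" for mu
    using that tC tau_in_square[of _ "Suc l"] by auto
  ultimately have "?E \<union> tau (Suc l) ` ?E
      = {mu \<in> square_partitions (Suc l). core mu \<in> ?C}"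
    by blast
  then show ?case
    using step.hyps by (subst descendants.simps) (simp add: ext)
qed

section \<open>The size of a fibre of the core map\<close>

definition fibre :: "nat list \<Rightarrow> nat \<Rightarrow> nat \<Rightarrow> nat list set" where
  "fibre lam l a = {mu \<in> square_partitions l. core mu = lam \<and> last mu \<ge> a}"

lemma finite_square: "n > 0 \<Longrightarrow> finite (square_partitions n)"
  by (rule finite_subset[OF _ finite_lists_length_eq[of "{..n}" n]]) (auto simp: mem_square)

lemma finite_fibre: "l > 0 \<Longrightarrow> finite (fibre lam l a)"
  unfolding fibre_def by (rule finite_subset[OF _ finite_square]) auto

text \<open>
  One level of the generating tree: the children with label \<open>a\<close> come by appending \<open>a\<close> to
  a parent with label at least \<open>a\<close>, or by undoing a peeling of a parent with label \<open>a - 1\<close>. In the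
  latter case the restored first part is the largest admissible one, for otherwise the last part
  would have been deleted by preference; this separates the two kinds of children.
\<close>

lemma fibre_last_eq:
  assumes "lam \<in> sq_partitions k" "k > 0" "l \<ge> k" "a > 0"
  shows "{mu \<in> fibre lam (Suc l) 0. last mu = a} =
    (\<lambda>nu. nu @ [a]) ` fibre lam l a \<union>
    (\<lambda>nu. Suc l # map Suc nu) ` {nu \<in> fibre lam l 0. last nu = a - 1}"
    (is "?L = ?app ` _ \<union> ?grow ` ?P")
proof (intro Set.set_eqI iffI)
  fix mu
  assume "mu \<in> ?L"
  then have mu: "mu \<in> square_partitions (Suc l)" "core mu = lam" "last mu = a"
    by (auto simp: fibre_def)
  note mu' = square_hd_last[OF mu(1)]
  from mu(1) zero_less_Suc show "mu \<in> ?app ` fibre lam l a \<union> ?grow ` ?P"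
  proof (cases rule: square_cases)
    case sq
    then show ?thesis
      using mu core_sq[OF sq] sq_length(1)[OF sq] sq_length(1)[OF assms(1)] assms(3) by simp
  next
    case (butlast n')
    have "last (butlast mu) \<in> set mu"
      using square_hd_last(1)[OF butlast(4,2)] by (meson in_set_butlastD last_in_set)
    then have "butlast mu \<in> fibre lam l a" using butlast mu mu' by (simp add: fibre_def)
    moreover have "mu = ?app (butlast mu)" using mu mu' append_butlast_last_id by force
    ultimately show ?thesis by blast
  next
    case (peel n')
    have "tl mu \<noteq> []" using square_hd_last(1)[OF peel(5,2)] by (simp add: peel_def)
    then have "last (peel mu) = a - 1"
      using mu by (simp add: peel_def last_map last_tl)
    then have "peel mu \<in> ?P" using peel mu by (simp add: fibre_def)
    moreover have "mu = ?grow (peel mu)"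
    proof -
      have "map (Suc \<circ> (\<lambda>x. x - 1)) (tl mu) = tl mu"
      proof (rule map_idI)
        fix x assume "x \<in> set (tl mu)"
        then have "x \<in> set mu" using mu'(1) by (simp add: list.set_sel(2))
        then have "last mu \<le> x" using mu'(6) by simp
        then show "(Suc \<circ> (\<lambda>x. x - 1)) x = x" using peel by simp
      qed
      then show ?thesis using peel(3) mu'(1) by (simp add: peel_def) (metis list.collapse)
    qed
    ultimately show ?thesis by blast
  qed
next
  have l: "l > 0" using assms by simp
  fix mu
  assume "mu \<in> ?app ` fibre lam l a \<union> ?grow ` ?P"
  then consider nu where "nu \<in> fibre lam l a" "mu = ?app nu" | nu where "nu \<in> ?P" "mu = ?grow nu"
    by blast
  then show "mu \<in> ?L"
  proof cases
    case 1
    then have nu: "nu \<in> square_partitions l" "core nu = lam" "a \<le> last nu"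
      by (auto simp: fibre_def)
    note nu' = square_hd_last[OF nu(1) l]
    have "a \<le> x \<and> 1 \<le> x \<and> x \<le> Suc l" if "x \<in> set nu" for x
      using nu(3) nu'(3,5) nu'(6,7)[OF that] by simp
    moreover have "a \<le> l" using nu(3) nu'(4,5) by simp
    moreover have "sorted_wrt (\<ge>) nu" using nu(1) l by (simp add: mem_square)
    ultimately have "mu \<in> square_partitions (Suc l)"
      using nu'(2) 1(2) assms(4) by (auto simp: mem_square sorted_wrt_append)
    moreover have "core mu = lam" using core_butlast[of mu] 1(2) nu nu' by simp
    ultimately show ?thesis using 1(2) by (simp add: fibre_def)
  next
    case 2
    then have nu: "nu \<in> square_partitions l" "core nu = lam" "last nu = a - 1"
      by (auto simp: fibre_def)
    note nu' = square_hd_last[OF nu(1) l]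
    have "mu \<in> square_partitions (Suc l)"
      using nu(1) 2(2) l by (auto simp: mem_square sorted_wrt_map)
    moreover have lst: "last mu = a" using 2(2) nu nu' assms(4) by (simp add: last_map)
    moreover have "core mu = lam"
    proof -
      have "core mu = core (peel mu)"
        using core_peel[OF \<open>mu \<in> square_partitions (Suc l)\<close>] lst nu(3) nu'(3) by simp
      moreover have "peel mu = nu" using 2(2) by (simp add: peel_def comp_def)
      ultimately show ?thesis using nu by simp
    qed
    ultimately show ?thesis by (simp add: fibre_def)
  qed
qed

lemma card_fibre_split:
  assumes "l > 0"
  shows "card (fibre lam l a) =
    card (fibre lam l (Suc a)) + card {mu \<in> fibre lam l 0. last mu = a}"
proof -
  have "fibre lam l a = fibre lam l (Suc a) \<union> {mu \<in> fibre lam l 0. last mu = a}"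
    by (auto simp: fibre_def)
  moreover have "fibre lam l (Suc a) \<inter> {mu \<in> fibre lam l 0. last mu = a} = {}"
    by (auto simp: fibre_def)
  ultimately show ?thesis using finite_fibre[OF assms] by (simp add: card_Un_disjoint)
qed

text \<open>
  Both kinds of children together are indexed by the parents with label at least \<open>a - 1\<close>.
\<close>

lemma card_fibre_last_eq:
  assumes "lam \<in> sq_partitions k" "k > 0" "l \<ge> k" "a > 0"
  shows "card {mu \<in> fibre lam (Suc l) 0. last mu = a} = card (fibre lam l (a - 1))"
proof -
  let ?app = "\<lambda>nu. nu @ [a]" and ?grow = "\<lambda>nu. Suc l # map Suc nu"
  let ?P = "{nu \<in> fibre lam l 0. last nu = a - 1}"
  have l: "l > 0" using assms by simp
  have "hd (nu @ [a]) \<le> l" if "nu \<in> fibre lam l a" for nu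
    using that square_hd_last[of nu l] l by (simp add: fibre_def)
  then have "?app ` fibre lam l a \<inter> ?grow ` ?P = {}" by fastforce
  moreover have "inj_on ?app (fibre lam l a)" "inj_on ?grow ?P"
    by (auto simp: inj_on_def)
  ultimately have "card {mu \<in> fibre lam (Suc l) 0. last mu = a} = card (fibre lam l a) + card ?P"
    unfolding fibre_last_eq[OF assms] using finite_fibre[OF l]
    by (simp add: card_Un_disjoint card_image)
  then show ?thesis using card_fibre_split[OF l, of lam "a - 1"] assms(4) by simp
qed

text \<open>
  Reflected ballot numbers. The form with lower indices \<open>m + 1\<close> and \<open>m + 2\<close> makes the value
  vanish for \<open>a > m + 1\<close>, also where the subtraction is truncated.
\<close>

definition ballot :: "nat \<Rightarrow> nat \<Rightarrow> int" where
  "ballot m a = int ((2 * m + 2 - a) choose (m + 1)) - int ((2 * m + 2 - a) choose (m + 2))"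

lemma ballot_0: "ballot m 0 = catalan (m + 1)"
  using binomial_symmetric[of "m + 2" "2 * m + 2"] by (simp add: ballot_def catalan_def)

lemma ballot_0_1: "ballot m 0 = ballot m 1"
  using binomial_symmetric[of m "2 * m + 1"] by (simp add: ballot_def)

lemma ballot_Suc:
  assumes "a > 0"
  shows "ballot (Suc m) a = ballot (Suc m) (Suc a) + ballot m (a - 1)"
proof (cases "a \<le> 2 * m + 3")
  case True
  define n where "n = 2 * m + 3 - a"
  have "2 * Suc m + 2 - a = Suc n" "2 * Suc m + 2 - Suc a = n" "2 * m + 2 - (a - 1) = n"
    using True assms by (auto simp: n_def)
  then show ?thesis by (simp add: ballot_def)
next
  case False
  then show ?thesis by (simp add: ballot_def)
qed

text \<open>
  The statement for \<open>Suc m\<close> follows by downward induction on \<open>a\<close>, starting at a value exceeding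
  every part. The recursion in \<open>a\<close> needs \<open>a > 0\<close>; no last part is 0, so \<open>a = 0\<close> reduces to \<open>a = 1\<close>.
\<close>

lemma card_fibre:
  assumes "lam \<in> sq_partitions k" "k > 0"
  shows "int (card (fibre lam (k + m) a)) = ballot m a"
proof (induction m arbitrary: a)
  case 0
  have *: "mu \<in> square_partitions k \<and> core mu = lam \<longleftrightarrow> mu = lam" for mu
    using core_in_sq[OF _ assms(2), of mu] core_sq[of mu k] core_sq[OF assms(1)]
      sq_length(1,2)[OF assms(1)] by metis
  have "mu \<in> fibre lam (k + 0) a \<longleftrightarrow> a \<le> 1 \<and> mu = lam" for mu
    using *[of mu] sq_length(3)[OF assms(1)] unfolding fibre_def
    by (cases "mu = lam") auto
  then have "fibre lam (k + 0) a = (if a \<le> 1 then {lam} else {})" by auto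
  moreover have "ballot 0 a = (if a \<le> 1 then 1 else 0)"
  proof -
    consider "a = 0" | "a = 1" | "a \<ge> 2" by linarith
    then show ?thesis by cases (simp_all add: ballot_def numeral_2_eq_2)
  qed
  ultimately show ?case by simp
next
  case (Suc m)
  let ?l = "k + Suc m"
  have empty: "fibre lam ?l a = {}" if "a > ?l" for a
  proof -
    have "last mu < a" if "mu \<in> square_partitions ?l" for mu
      using square_hd_last(4,5)[OF that] \<open>a > ?l\<close> by simp
    then show ?thesis unfolding fibre_def by (auto simp: not_le[symmetric])
  qed
  have pos: "int (card (fibre lam ?l a)) = ballot (Suc m) a" if "a > 0" for a
  proof (cases "a \<le> Suc ?l")
    case False
    then show ?thesis using empty[of a] by (simp add: ballot_def binomial_eq_0)
  next
    case True
    then show ?thesis using that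
    proof (induction rule: inc_induct)
      case base
      show ?case using empty[of "Suc ?l"] assms(2) by (simp add: ballot_def binomial_eq_0)
    next
      case (step a)
      have "int (card (fibre lam ?l a)) = ballot (Suc m) (Suc a) + ballot m (a - 1)"
        using card_fibre_split[of ?l lam a] card_fibre_last_eq[OF assms, of "k + m" a]
          step Suc.IH[of "a - 1"] by simp
      then show ?case using ballot_Suc[OF step.prems, of m] by simp
    qed
  qed
  have "fibre lam ?l 0 = fibre lam ?l 1"
    using square_hd_last(3)[of _ ?l] by (auto simp: fibre_def)
  then show ?case using pos[of a] pos[of 1] ballot_0_1[of "Suc m"] by (cases "a = 0") auto
qed

lemma card_descendants:
  assumes "lam \<in> sq_partitions k" "k > 0" "l \<ge> k"
  shows "int (card (descendants k lam l)) =
    (if lam = tau k lam then catalan (l - k + 1) else 2 * catalan (l - k + 1))"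
proof -
  note t = tau_sq[OF assms(1,2)]
  have D: "descendants k lam l = fibre lam l 0 \<union> fibre (tau k lam) l 0"
    unfolding descendants_core[OF assms] by (auto simp: fibre_def)
  have c: "int (card (fibre nu l 0)) = catalan (l - k + 1)" if "nu \<in> sq_partitions k" for nu
    using card_fibre[OF that assms(2), of "l - k" 0] assms(3) ballot_0 by simp
  show ?thesis
  proof (cases "lam = tau k lam")
    case True
    then show ?thesis using D c[OF assms(1)] by simp
  next
    case False
    then have "fibre lam l 0 \<inter> fibre (tau k lam) l 0 = {}" by (auto simp: fibre_def)
    then have "card (descendants k lam l) = card (fibre lam l 0) + card (fibre (tau k lam) l 0)"
      unfolding D using finite_fibre assms by (simp add: card_Un_disjoint)
    then show ?thesis using False c[OF assms(1)] c[OF t] by simp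
  qed
qed

section \<open>The decomposition\<close>

lemma descendants_disjoint:
  assumes "lam \<in> sq_partitions k" "k > 0" "nu \<in> sq_partitions s" "s > 0"
    and "nu \<notin> {lam, tau k lam}" "l \<ge> max k s"
  shows "descendants k lam l \<inter> descendants s nu l = {}"
proof (rule ccontr)
  assume "descendants k lam l \<inter> descendants s nu l \<noteq> {}"
  then obtain mu where "core mu \<in> {lam, tau k lam}" "core mu \<in> {nu, tau s nu}"
    using descendants_core[of lam k l] descendants_core[of nu s l] assms by auto
  moreover from this have "s = k"
    using sq_length(1)[OF assms(1)] sq_length(1)[OF assms(3)]
      sq_length(1)[OF tau_sq[OF assms(1,2)]] sq_length(1)[OF tau_sq[OF assms(3,4)]] by auto
  moreover have "tau k (tau k lam) = lam" "tau s (tau s nu) = nu"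
    using tau_tau sq_length(2) assms by blast+
  ultimately show False using assms(5) by auto
qed

lemma descendants_tau:
  assumes "lam \<in> sq_partitions k" "k > 0" "l \<ge> k"
  shows "descendants k (tau k lam) l = descendants k lam l"
  unfolding descendants_core[OF assms] descendants_core[OF tau_sq[OF assms(1,2)] assms(2,3)]
    tau_tau[OF sq_length(2)[OF assms(1)]]
  by auto

lemma descendants_partition:
  assumes "l > 0" "is_transversal l R"
  shows "disjoint_family_on (\<lambda>lam. descendants (length lam) lam l) R"
    and "square_partitions l = (\<Union>lam\<in>R. descendants (length lam) lam l)"
proof -
  have sq: "lam \<in> sq_partitions (length lam) \<and> 0 < length lam \<and> length lam \<le> l"
    if lam: "lam \<in> R" for lam
  proof -
    have "R \<subseteq> (\<Union>k\<in>{1..l}. sq_partitions k)"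
      by (rule conjunct1[OF assms(2)[unfolded is_transversal_def]])
    then obtain k where "k \<in> {1..l}" "lam \<in> sq_partitions k" using lam by blast
    then show ?thesis using sq_length(1)[of lam k] by simp
  qed
  have uniq: "\<exists>!mu. mu \<in> R \<and> mu \<in> {lam, tau (length lam) lam}"
    if "lam \<in> sq_partitions (length lam)" "0 < length lam" "length lam \<le> l" for lam
  proof -
    have "\<forall>k\<in>{1..l}. \<forall>lam\<in>sq_partitions k. \<exists>!mu. mu \<in> R \<and> mu \<in> {lam, tau k lam}"
      by (rule conjunct2[OF assms(2)[unfolded is_transversal_def]])
    moreover have "length lam \<in> {1..l}" using that(2,3) by (simp add: Suc_le_eq)
    ultimately have "\<forall>nu\<in>sq_partitions (length lam).
        \<exists>!mu. mu \<in> R \<and> mu \<in> {nu, tau (length lam) nu}"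
      by (rule bspec)
    then show ?thesis using that(1) by (rule bspec)
  qed
  show "disjoint_family_on (\<lambda>lam. descendants (length lam) lam l) R"
    unfolding disjoint_family_on_def
  proof (intro ballI impI)
    fix lam nu assume R: "lam \<in> R" "nu \<in> R" "lam \<noteq> nu"
    have "nu \<notin> {lam, tau (length lam) lam}"
    proof
      assume "nu \<in> {lam, tau (length lam) lam}"
      moreover have "\<exists>!mu. mu \<in> R \<and> mu \<in> {lam, tau (length lam) lam}"
        using uniq[of lam] sq[OF R(1)] by blast
      ultimately show False using R by (metis insertI1)
    qed
    then show "descendants (length lam) lam l \<inter> descendants (length nu) nu l = {}"
      using sq[OF R(1)] sq[OF R(2)] by (intro descendants_disjoint) auto
  qed
  show "square_partitions l = (\<Union>lam\<in>R. descendants (length lam) lam l)" (is "_ = ?U")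
  proof (intro Set.set_eqI iffI)
    fix mu assume mu: "mu \<in> square_partitions l"
    define c where "c = core mu"
    have c: "c \<in> sq_partitions (length c)" "0 < length c" "length c \<le> l"
      using core_in_sq[OF mu assms(1)] by (simp_all add: c_def)
    then have "mu \<in> descendants (length c) c l"
      using descendants_core[OF c] mu by (simp add: c_def)
    moreover obtain lam where lam: "lam \<in> R" "lam \<in> {c, tau (length c) c}" using uniq[OF c] by blast
    moreover have "length lam = length c" using lam by (auto simp: tau_def)
    moreover have "descendants (length c) lam l = descendants (length c) c l"
      using lam(2) descendants_tau[OF c] by blast
    ultimately have "mu \<in> descendants (length lam) lam l" by simp
    then show "mu \<in> ?U" using lam(1) by blast
  next
    fix mu assume "mu \<in> ?U"
    then obtain lam where lam: "lam \<in> R" "mu \<in> descendants (length lam) lam l" by blast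
    then show "mu \<in> square_partitions l"
      using descendants_core[of lam "length lam" l] sq[of lam] by simp
  qed
qed

theorem mainTheorem1:
  "(\<forall>(l::nat) (k::nat) lam. k \<ge> 1 \<and> l \<ge> k \<and> lam \<in> sq_partitions k \<longrightarrow>
      int (card (descendants k lam l)) =
        (if lam = tau k lam then catalan (l - k + 1) else 2 * catalan (l - k + 1)))
   \<and> (\<forall>(k::nat) (s::nat) lam nu.
        k \<ge> 1 \<and> s \<ge> 1 \<and> lam \<in> sq_partitions k \<and> nu \<in> sq_partitions s \<and>
        nu \<notin> {lam, tau k lam} \<longrightarrow>
        (\<forall>l \<ge> max k s. descendants k lam l \<inter> descendants s nu l = {}))
   \<and> (\<forall>l::nat. l \<ge> 1 \<longrightarrow>
        (\<forall>k\<in>{1..l}. \<forall>lam\<in>sq_partitions k.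
            descendants k lam l = descendants k (tau k lam) l) \<and>
        (\<forall>R. is_transversal l R \<longrightarrow>
            disjoint_family_on (\<lambda>lam. descendants (length lam) lam l) R \<and>
            square_partitions l = (\<Union>lam\<in>R. descendants (length lam) lam l)))"
proof (intro conjI allI impI ballI; (elim conjE)?)
  fix l k :: nat and lam
  assume "k \<ge> 1" "l \<ge> k" "lam \<in> sq_partitions k"
  then show "int (card (descendants k lam l)) =
      (if lam = tau k lam then catalan (l - k + 1) else 2 * catalan (l - k + 1))"
    using card_descendants by simp
next
  fix k s :: nat and lam nu l
  assume "k \<ge> 1" "s \<ge> 1" "lam \<in> sq_partitions k" "nu \<in> sq_partitions s"
    "nu \<notin> {lam, tau k lam}" "l \<ge> max k s"
  then show "descendants k lam l \<inter> descendants s nu l = {}"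
    by (intro descendants_disjoint) auto
next
  fix l k lam
  assume "k \<in> {1..l}" "lam \<in> sq_partitions k"
  then show "descendants k lam l = descendants k (tau k lam) l"
    using descendants_tau[of lam k l] by simp
next
  fix l :: nat and R
  assume "l \<ge> 1" "is_transversal l R"
  then show "disjoint_family_on (\<lambda>lam. descendants (length lam) lam l) R"
    using descendants_partition by simp
next
  fix l :: nat and R
  assume "l \<ge> 1" "is_transversal l R"
  then show "square_partitions l = (\<Union>lam\<in>R. descendants (length lam) lam l)"
    using descendants_partition by simp
qed

end
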